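(* Let $\varepsilon,s,t,r,N,M>0$ satisfy $\varepsilon\le 1/10$, $\frac{4s}{t}+\frac{r}{2\varepsilon s}\le\varepsilon$ and $M\ge(1+100\varepsilon)N$. Let $\mathcal{H}$ be a $3$-uniform hypergraph on $M$ vertices which admits an $r$-rooting function $f$ such that $\mathcal{H}$ (with respect to $f$) is $(\varepsilon,N,s,t)$-nice. Then there exists a family $\mathcal{C}\subseteq\mathcal{P}(V(\mathcal{H}))$ such that: (1) for every independent set $I\subseteq V(\mathcal{H})$ there is $C_I\in\mathcal{C}$ with $I\subseteq C_I$; (2) $\log_2|\mathcal{C}|\le\frac{2M}{\varepsilon}\left(H(2s/t)+H\left(\frac{r}{4\varepsilon s}\right)\right)$; (3) every $C\in\mathcal{C}$ satisfies $|C|\le(1+100\varepsilon)N$.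
   Context: $H(p)=-p\log_2 p-(1-p)\log_2(1-p)$ is the binary entropy function. An independent set is a vertex set containing no edge. An $r$-rooting function for a $3$-uniform hypergraph $\mathcal{H}$ is a function $f:E(\mathcal{H})\to V(\mathcal{H})$ such that $f(e)\in e$ for every edge $e$, and for every pair of vertices $u,v$ there are at most $r$ edges $e$ with $u,v\in e$ and $f(e)\notin\{u,v\}$. For $A\subseteq V(\mathcal{H})$ and $v\in A$, the head link graph $\mathrm{HL}_v(\mathcal{H}\cap A)$ is the graph on vertex set $A$ whose edges are pairs $\{u_1,u_2\}\subseteq A$ with $\{v,u_1,u_2\}\in E(\mathcal{H})$ and $f(\{v,u_1,u_2\})=v$. A vertex $v\in A$ is $(A,s,t)$-eligible if $\mathrm{HL}_v(\mathcal{H}\cap A)$ has a subgraph of maximum degree at most $s$ with at least $t$ edges. $\mathcal{H}$ is $(\varepsilon,N,s,t)$-nice if every $A\subseteq V(\mathcal{H})$ with $|A|\ge(1+\varepsilon)N$ contains an $(A,s,t)$-eligible vertex. *)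

theory Defs
  imports Complex_Main
begin

text \<open>
  A (hyper)graph is a vertex set \<open>V\<close> together with a set \<open>E\<close> of edges, each edge being a set of
  vertices.
\<close>

definition binary_entropy :: "real \<Rightarrow> real" where
  "binary_entropy p = - p * log 2 p - (1 - p) * log 2 (1 - p)"

definition three_uniform_hypergraph :: "'a set \<Rightarrow> 'a set set \<Rightarrow> bool" where
  "three_uniform_hypergraph V E \<longleftrightarrow> finite V \<and> (\<forall>e\<in>E. e \<subseteq> V \<and> card e = 3)"

definition independent_set :: "'a set \<Rightarrow> 'a set set \<Rightarrow> 'a set \<Rightarrow> bool" where
  "independent_set V E I \<longleftrightarrow> I \<subseteq> V \<and> (\<forall>e\<in>E. \<not> e \<subseteq> I)"

text \<open>
  A rooting function is a total function on sets of vertices of which only the values on \<open>E\<close> matter.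
  A pair of vertices consists of two distinct vertices.
\<close>

definition rooting_function :: "real \<Rightarrow> 'a set \<Rightarrow> 'a set set \<Rightarrow> ('a set \<Rightarrow> 'a) \<Rightarrow> bool" where
  "rooting_function r V E f \<longleftrightarrow>
     (\<forall>e\<in>E. f e \<in> e) \<and>
     (\<forall>u\<in>V. \<forall>v\<in>V. u \<noteq> v \<longrightarrow> real (card {e\<in>E. u \<in> e \<and> v \<in> e \<and> f e \<notin> {u, v}}) \<le> r)"

text \<open>The edge set of the head link graph of \<open>v\<close>; its vertex set is \<open>A\<close>.\<close>

definition head_link :: "'a set set \<Rightarrow> ('a set \<Rightarrow> 'a) \<Rightarrow> 'a set \<Rightarrow> 'a \<Rightarrow> 'a set set" where
  "head_link E f A v =
     {{u1, u2} | u1 u2. u1 \<in> A \<and> u2 \<in> A \<and> u1 \<noteq> u2 \<and> {v, u1, u2} \<in> E \<and> f {v, u1, u2} = v}"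

definition graph_degree :: "'a set set \<Rightarrow> 'a \<Rightarrow> nat" where
  "graph_degree F u = card {e\<in>F. u \<in> e}"

text \<open>
  Isolated vertices affect neither the number of edges nor an upper bound on the degrees, so a
  subgraph of the head link graph is given by its edge set \<open>F\<close> alone.
\<close>

definition eligible ::
  "'a set set \<Rightarrow> ('a set \<Rightarrow> 'a) \<Rightarrow> 'a set \<Rightarrow> real \<Rightarrow> real \<Rightarrow> 'a \<Rightarrow> bool" where
  "eligible E f A s t v \<longleftrightarrow>
     v \<in> A \<and>
     (\<exists>F \<subseteq> head_link E f A v. (\<forall>u\<in>A. real (graph_degree F u) \<le> s) \<and> real (card F) \<ge> t)"

definition nice ::
  "'a set \<Rightarrow> 'a set set \<Rightarrow> ('a set \<Rightarrow> 'a) \<Rightarrow> real \<Rightarrow> real \<Rightarrow> real \<Rightarrow> real \<Rightarrow> bool" where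
  "nice V E f \<epsilon> N s t \<longleftrightarrow>
     (\<forall>A \<subseteq> V. real (card A) \<ge> (1 + \<epsilon>) * N \<longrightarrow> (\<exists>v. eligible E f A s t v))"

end

theory Submission
  imports Defs
begin

text \<open>
  If \<open>A\<close> has more than \<open>(1 + 100 * \<epsilon>) * N\<close> vertices, then a fingerprint \<open>(T, S)\<close> of the independent set
  \<open>I \<subseteq> A\<close> determines a container of size at most \<open>(1 - \<epsilon> / 2) * |A|\<close>. Eligible vertices are
  considered one after the other; those in \<open>I\<close> form \<open>T\<close>, and the chosen subgraphs of their head
  links have union \<open>W\<close>, with degrees between \<open>3 * s\<close> and \<open>4 * s\<close> at saturated vertices. As \<open>W\<close>
  has at least \<open>t * |T|\<close> and at most \<open>2 * s * |A|\<close> edges, \<open>|T| \<le> (2 * s / t) * |A|\<close>. Either many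
  of the considered vertices lie outside \<open>I\<close> and can be deleted, or there are many saturated
  vertices, so \<open>W\<close> has at least \<open>12 * \<epsilon> * s * |A|\<close> edges. In the latter case, since \<open>I\<close> is
  independent in \<open>W\<close> and edges have multiplicity at most \<open>r\<close>, the container algorithm for graphs
  with degree threshold \<open>4 * \<epsilon> * s / r\<close> produces \<open>S\<close> and removes many vertices. Iterating the
  step, the exponents sum to a geometric series with ratio \<open>1 - \<epsilon> / 2\<close>.
\<close>

section \<open>Binary entropy and the number of small subsets\<close>

lemma binary_entropy_nonneg:
  assumes "0 < p" "p \<le> 1 / 2"
  shows "binary_entropy p \<ge> 0"
proof -
  have "log 2 p \<le> 0" "log 2 (1 - p) \<le> 0"
    using assms by auto
  then have "p * log 2 p \<le> 0" "(1 - p) * log 2 (1 - p) \<le> 0"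
    using assms by (auto intro: mult_nonneg_nonpos)
  then show ?thesis
    by (simp add: binary_entropy_def)
qed

lemma powr_binary_entropy:
  assumes "0 < p" "p < 1"
  shows "2 powr (- (x * binary_entropy p)) = p powr (p * x) * (1 - p) powr (x - p * x)"
proof -
  have "p powr (p * x) = 2 powr (log 2 p * (p * x))"
    "(1 - p) powr (x - p * x) = 2 powr (log 2 (1 - p) * (x - p * x))"
    using assms by (simp_all add: powr_powr [symmetric])
  then show ?thesis
    by (simp add: powr_add [symmetric] binary_entropy_def algebra_simps)
qed

text \<open>Weight each \<open>S\<close> by the probability \<open>?w S\<close> that a random subset
  of \<open>A\<close>, containing each element independently with probability \<open>p\<close>,
  equals \<open>S\<close>. All weights together sum to 1, and each counted set weighs at least the
  inverse of the claimed bound.\<close>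

lemma card_small_subsets_le:
  assumes "finite A" and p: "0 < p" "p \<le> 1 / 2"
  shows "real (card {S. S \<subseteq> A \<and> real (card S) \<le> p * real (card A)})
           \<le> 2 powr (real (card A) * binary_entropy p)"
proof -
  let ?n = "card A"
  let ?F = "{S. S \<subseteq> A \<and> real (card S) \<le> p * real ?n}"
  let ?w = "\<lambda>S. p ^ card S * (1 - p) ^ (?n - card S)"
  have weight: "2 powr (- (real ?n * binary_entropy p)) \<le> ?w S" if "S \<in> ?F" for S
  proof -
    let ?k = "card S"
    have le: "?k \<le> ?n" using that assms by (auto intro: card_mono)
    \<comment> \<open>\<open>x\<close> is the shortfall from the extremal, possibly non-integral
      size \<open>p * ?n\<close>. Each missing element trades a factor \<open>p\<close> for
      \<open>1 - p\<close>, which is no smaller because \<open>p \<le> 1 / 2\<close>.\<close>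
    define x where "x = p * real ?n - real ?k"
    have x: "x \<ge> 0" using that by (simp add: x_def)
    have "2 powr (- (real ?n * binary_entropy p))
            = p powr (real ?k + x) * (1 - p) powr (real (?n - ?k) - x)"
      using p le by (simp add: powr_binary_entropy x_def of_nat_diff)
    also have "\<dots> = ?w S * (p powr x / (1 - p) powr x)"
      using p by (simp add: powr_add powr_diff powr_realpow)
    also have "\<dots> \<le> ?w S * 1"
      using p x by (intro mult_left_mono) (auto intro!: powr_mono2 simp: divide_le_eq_1)
    finally show ?thesis by simp
  qed
  have "real (card ?F) * 2 powr (- (real ?n * binary_entropy p)) \<le> (\<Sum>S\<in>?F. ?w S)"
    using sum_bounded_below [of ?F "2 powr (- (real ?n * binary_entropy p))" ?w] weight by simp
  also have "\<dots> \<le> (\<Sum>S\<in>Pow A. ?w S)"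
    using assms by (intro sum_mono2) auto
  also have "\<dots> = (\<Sum>k\<le>?n. \<Sum>S\<in>{S \<in> Pow A. card S = k}. ?w S)"
    using assms by (intro sum.group [symmetric]) (auto intro: card_mono)
  also have "\<dots> = (\<Sum>k\<le>?n. of_nat (?n choose k) * p ^ k * (1 - p) ^ (?n - k))"
    using n_subsets [OF \<open>finite A\<close>] by (intro sum.cong) (auto simp: mult.assoc)
  also have "\<dots> = (p + (1 - p)) ^ ?n"
    by (rule binomial_ring [symmetric])
  finally have "real (card ?F) * 2 powr (- (real ?n * binary_entropy p)) \<le> 1"
    by simp
  then show ?thesis
    by (simp add: powr_minus field_simps)
qed

section \<open>The container algorithm for graphs\<close>

text \<open>While some \<open>u\<close> has at least \<open>d\<close> neighbours in
  \<open>B\<close>, ask whether \<open>u\<close> lies in \<open>I\<close>. If not, delete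
  \<open>u\<close>; if so, put \<open>u\<close> into \<open>S\<close> and delete it with its
  neighbours. The choice of \<open>u\<close> depends on \<open>B\<close> only, so the run can be
  replayed from \<open>S\<close>; hence \<open>g\<close> is quantified before
  \<open>I\<close>.\<close>

lemma graph_container:
  fixes adj :: "'a \<Rightarrow> 'a \<Rightarrow> bool" and d :: real
  assumes "finite B"
  shows "\<exists>g. \<forall>I. (\<forall>u\<in>I. \<forall>w\<in>I. \<not> adj u w) \<longrightarrow>
           (\<exists>S \<subseteq> I \<inter> B. d * real (card S) \<le> real (card B) \<and> I \<inter> B \<subseteq> S \<union> g S \<and> g S \<subseteq> B \<and>
              (\<forall>u\<in>g S. real (card {w \<in> g S. adj u w}) < d))"
    (is "\<exists>g. \<forall>I. ?indep I \<longrightarrow> ?P B g I")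
  using assms
proof (induction B rule: finite_psubset_induct)
  case (psubset B)
  show ?case
  proof (cases "\<forall>u\<in>B. real (card {w \<in> B. adj u w}) < d")
    case True
    then show ?thesis
      by (intro exI [of _ "\<lambda>_. B"] allI impI exI [of _ "{}"]) auto
  next
    case False
    then obtain u where u: "u \<in> B" "real (card {w \<in> B. adj u w}) \<ge> d"
      by force
    define B1 where "B1 = B - {u} - {w. adj u w}"
    have "B - {u} \<subset> B" "B1 \<subset> B"
      using u by (auto simp: B1_def)
    from psubset.IH [OF this(1)] obtain g0 where g0: "\<forall>I. ?indep I \<longrightarrow> ?P (B - {u}) g0 I" ..
    from psubset.IH [OF \<open>B1 \<subset> B\<close>] obtain g1 where g1: "\<forall>I. ?indep I \<longrightarrow> ?P B1 g1 I" ..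
    \<comment> \<open>Membership of \<open>u\<close> in \<open>S\<close> records the answer to the
      query, so it selects the branch to replay.\<close>
    let ?g = "\<lambda>S. if u \<in> S then g1 (S - {u}) else g0 S"
    show ?thesis
    proof (intro exI [of _ ?g] allI impI)
      fix I
      assume indep: "?indep I"
      show "?P B ?g I"
      proof (cases "u \<in> I")
        case False
        obtain S where S: "S \<subseteq> I \<inter> (B - {u})" "d * real (card S) \<le> real (card (B - {u}))"
          "I \<inter> (B - {u}) \<subseteq> S \<union> g0 S" "g0 S \<subseteq> B - {u}"
          "\<forall>u\<in>g0 S. real (card {w \<in> g0 S. adj u w}) < d"
          using g0 [THEN spec, THEN mp, OF indep] by (elim exE conjE) (rule that)
        have "u \<notin> S" using S by auto
        moreover have "card (B - {u}) \<le> card B" using psubset.hyps by (simp add: card_mono)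
        ultimately show ?thesis
          using S False by (intro exI [of _ S]) auto
      next
        case True
        obtain S where S: "S \<subseteq> I \<inter> B1" "d * real (card S) \<le> real (card B1)"
          "I \<inter> B1 \<subseteq> S \<union> g1 S" "g1 S \<subseteq> B1"
          "\<forall>u\<in>g1 S. real (card {w \<in> g1 S. adj u w}) < d"
          using g1 [THEN spec, THEN mp, OF indep] by (elim exE conjE) (rule that)
        have uS: "u \<notin> S" and fin: "finite S"
          using S psubset.hyps by (auto simp: B1_def intro: finite_subset)
        \<comment> \<open>Each vertex put into \<open>S\<close> costs \<open>B\<close> at least
          \<open>d\<close> vertices, which pays for the bound on \<open>card S\<close>.\<close>
        have "card B1 + card {w \<in> B. adj u w} = card (B1 \<union> {w \<in> B. adj u w})"
          using psubset.hyps by (subst card_Un_disjoint) (auto simp: B1_def)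
        also have "\<dots> \<le> card B"
          using psubset.hyps by (intro card_mono) (auto simp: B1_def)
        finally have "d * real (card (insert u S)) \<le> real (card B)"
          using S(2) u(2) uS fin by (simp add: algebra_simps)
        moreover have "I \<inter> B \<subseteq> insert u S \<union> g1 S"
          using S(3) indep True by (auto simp: B1_def)
        ultimately show ?thesis
          using S uS u(1) True by (intro exI [of _ "insert u S"]) (auto simp: B1_def)
      qed
    qed
  qed
qed

section \<open>Labelled head link edges and the selection of eligible vertices\<close>

text \<open>An edge carries its head as a label, so a pair lying in several head links is counted
  once for each head.\<close>

definition labelled_degree :: "('b \<times> 'a set) set \<Rightarrow> 'a \<Rightarrow> nat" where
  "labelled_degree W u = card {x \<in> W. u \<in> snd x}"

text \<open>For a rooted 3-uniform hypergraph these pairs correspond to the edges inside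
  \<open>A\<close>, each split into its root and the other two vertices.\<close>

definition head_pairs :: "'a set set \<Rightarrow> ('a set \<Rightarrow> 'a) \<Rightarrow> 'a set \<Rightarrow> ('a \<times> 'a set) set" where
  "head_pairs E f A = Sigma A (head_link E f A)"

lemma head_link_mono: "B \<subseteq> A \<Longrightarrow> head_link E f B v \<subseteq> head_link E f A v"
  by (auto simp: head_link_def)

lemma head_link_subset_Pow: "head_link E f A v \<subseteq> Pow A"
  by (auto simp: head_link_def)

lemma finite_head_link: "finite A \<Longrightarrow> finite (head_link E f A v)"
  by (rule finite_subset [OF head_link_subset_Pow]) simp

lemma finite_head_pairs: "finite A \<Longrightarrow> finite (head_pairs E f A)"
  by (simp add: head_pairs_def finite_head_link)

lemma head_pairsD:
  assumes "(v, e) \<in> head_pairs E f A"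
  shows "v \<in> A" "e \<subseteq> A" "card e = 2" "insert v e \<in> E" "f (insert v e) = v"
  using assms by (auto simp: head_pairs_def head_link_def)

lemma labelled_degree_mono: "finite W' \<Longrightarrow> W \<subseteq> W' \<Longrightarrow> labelled_degree W u \<le> labelled_degree W' u"
  unfolding labelled_degree_def by (intro card_mono) auto

lemma labelled_degree_Un_Pair:
  assumes "finite W" "finite F" "\<forall>e. (v, e) \<notin> W"
  shows "labelled_degree (W \<union> Pair v ` F) u = labelled_degree W u + graph_degree F u"
proof -
  have "{x \<in> W \<union> Pair v ` F. u \<in> snd x} = {x \<in> W. u \<in> snd x} \<union> Pair v ` {e \<in> F. u \<in> e}"
    by (simp add: set_eq_iff image_iff) blast
  moreover have "card \<dots> = card {x \<in> W. u \<in> snd x} + card (Pair v ` {e \<in> F. u \<in> e})"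
    using assms by (intro card_Un_disjoint) auto
  ultimately show ?thesis
    by (simp add: labelled_degree_def graph_degree_def card_image inj_on_def)
qed

text \<open>Handshake identity with multiplicities.\<close>

lemma sum_labelled_degree:
  assumes "finite A" "finite W" "\<forall>x\<in>W. snd x \<subseteq> A \<and> card (snd x) = 2"
  shows "(\<Sum>u\<in>A. labelled_degree W u) = 2 * card W"
  unfolding labelled_degree_def
proof (rule sum_multicount)
  show "\<forall>j\<in>W. card {i \<in> A. i \<in> snd j} = 2"
    using assms(3) by (auto simp: Int_absorb1 Collect_conj_eq)
qed (use assms in auto)

text \<open>
  A set \<open>T\<close> of eligible vertices of \<open>I\<close> is selected one vertex at a time. A vertex is
  discarded once its degree in the union \<open>W\<close> of the chosen subgraphs reaches \<open>3 * s\<close>, so no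
  degree ever exceeds \<open>4 * s\<close>. The function \<open>g\<close> shows that the outcome of the process, including
  the set \<open>R\<close> of considered vertices outside \<open>I\<close>, can be recovered from \<open>T\<close> alone.
\<close>

lemma eligible_selection:
  assumes "finite A" "B \<subseteq> A" "W \<subseteq> head_pairs E f A"
    and "\<forall>x\<in>W. fst x \<notin> B"
    and "\<forall>u. real (labelled_degree W u) \<le> 4 * s"
    and "\<forall>u\<in>B. real (labelled_degree W u) < 3 * s"
    and elig: "\<And>B'. B' \<subseteq> A \<Longrightarrow> real (card B') \<ge> m \<Longrightarrow> \<exists>v. eligible E f B' s t v"
  shows "\<exists>g. \<forall>I. \<exists>T \<subseteq> I \<inter> B. \<exists>R W'. g T = (R, W') \<and> R \<subseteq> B \<and> R \<inter> I = {} \<and>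
           W \<subseteq> W' \<and> W' \<subseteq> head_pairs E f A \<and> fst ` W' \<subseteq> fst ` W \<union> T \<and>
           (\<forall>u. real (labelled_degree W' u) \<le> 4 * s) \<and>
           real (card W') \<ge> real (card W) + t * real (card T) \<and>
           real (card (B - R - T - {u. real (labelled_degree W' u) \<ge> 3 * s})) < m"
    (is "\<exists>g. \<forall>I. ?P B W g I")
proof -
  have "finite B" using assms(1,2) finite_subset by blast
  then show ?thesis using assms(2-6)
  proof (induction B arbitrary: W rule: finite_psubset_induct)
    case (psubset B)
    have W: "finite W"
      using psubset.prems finite_head_pairs [OF \<open>finite A\<close>] finite_subset by blast
    show ?case
    proof (cases "real (card B) < m")
      \<comment> \<open>Below the threshold \<open>m\<close> no eligible vertex is guaranteed, so
        the process stops with \<open>T\<close> and \<open>R\<close> empty.\<close>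
      case True
      have "card (B - {u. real (labelled_degree W u) \<ge> 3 * s}) \<le> card B"
        using psubset.hyps by (intro card_mono) auto
      then show ?thesis
        using True psubset.prems
        by (intro exI [of _ "\<lambda>_. ({}, W)"] allI exI [of _ "{}"]) auto
    next
      case False
      then obtain v F where v: "v \<in> B" and F: "F \<subseteq> head_link E f B v"
        "\<forall>u\<in>B. real (graph_degree F u) \<le> s" "real (card F) \<ge> t"
        using elig [of B] psubset.prems(1) by (auto simp: eligible_def)
      have finF: "finite F"
        using F(1) finite_head_link [OF psubset.hyps] finite_subset by blast
      have vW: "\<forall>e. (v, e) \<notin> W"
        using psubset.prems(3) v by auto
      define W1 where "W1 = W \<union> Pair v ` F"
      \<comment> \<open>Dropping saturated vertices restores the invariant that degrees on the
        current set are below \<open>3 * s\<close>.\<close>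
      define B1 where "B1 = B - {v} - {u. real (labelled_degree W1 u) \<ge> 3 * s}"
      \<comment> \<open>Inside \<open>B\<close> a degree below \<open>3 * s\<close> grows by at most
        \<open>s\<close>; outside \<open>B\<close> the subgraph \<open>F\<close> has no
        edges.\<close>
      have deg: "real (labelled_degree W1 u) \<le> 4 * s" for u
      proof (cases "u \<in> B")
        case True
        then show ?thesis
          using F(2) psubset.prems(5) labelled_degree_Un_Pair [OF W finF vW, of u]
          by (fastforce simp: W1_def)
      next
        case False
        then have "{e \<in> F. u \<in> e} = {}"
          using F(1) head_link_subset_Pow [of E f B v] by blast
        then have "graph_degree F u = 0"
          by (simp only: graph_degree_def card.empty)
        then show ?thesis
          using psubset.prems(4) labelled_degree_Un_Pair [OF W finF vW, of u]
          by (simp add: W1_def)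
      qed
      have W1: "W1 \<subseteq> head_pairs E f A"
        using psubset.prems(1,2) F(1) v head_link_mono [OF psubset.prems(1)]
        by (fastforce simp: W1_def head_pairs_def)
      have cardW1: "card W1 = card W + card F"
        unfolding W1_def using W finF vW
        by (subst card_Un_disjoint) (auto simp: card_image inj_on_def)
      have "B - {v} \<subset> B" "B1 \<subset> B" using v by (auto simp: B1_def)
      have "\<forall>x\<in>W. fst x \<notin> B - {v}" "\<forall>u\<in>B - {v}. real (labelled_degree W u) < 3 * s" "B - {v} \<subseteq> A"
        using psubset.prems by auto
      from psubset.IH [OF \<open>B - {v} \<subset> B\<close> this(3) psubset.prems(2) this(1) psubset.prems(4) this(2)]
      obtain g0 where g0: "\<forall>I. ?P (B - {v}) W g0 I" ..
      have pre: "B1 \<subseteq> A" "\<forall>x\<in>W1. fst x \<notin> B1" "\<forall>u\<in>B1. real (labelled_degree W1 u) < 3 * s"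
        using psubset.prems(1,3) by (auto simp: B1_def W1_def)
      have "\<forall>u. real (labelled_degree W1 u) \<le> 4 * s"
        using deg by blast
      from psubset.IH [OF \<open>B1 \<subset> B\<close> pre(1) W1 pre(2) this pre(3)]
      obtain g1 where g1: "\<forall>I. ?P B1 W1 g1 I" ..
      \<comment> \<open>As \<open>v\<close> is in \<open>T\<close> exactly when it is in
        \<open>I\<close>, the branch is known from \<open>T\<close>; a rejected \<open>v\<close> is
        recorded in \<open>R\<close>.\<close>
      let ?g = "\<lambda>T. if v \<in> T then g1 (T - {v}) else (insert v (fst (g0 T)), snd (g0 T))"
      show ?thesis
      proof (rule exI [of _ ?g], rule allI)
        fix I
        show "?P B W ?g I"
        proof (cases "v \<in> I")
          case False
          obtain T R W' where *: "T \<subseteq> I \<inter> (B - {v})" "g0 T = (R, W')" "R \<subseteq> B - {v}"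
            "R \<inter> I = {}" "W \<subseteq> W'" "W' \<subseteq> head_pairs E f A" "fst ` W' \<subseteq> fst ` W \<union> T"
            "\<forall>u. real (labelled_degree W' u) \<le> 4 * s"
            "real (card W') \<ge> real (card W) + t * real (card T)"
            "real (card (B - {v} - R - T - {u. real (labelled_degree W' u) \<ge> 3 * s})) < m"
            using g0 [THEN spec, of I] by (elim exE conjE) (rule that)
          have "B - insert v R - T - X = B - {v} - R - T - X" for X
            by auto
          then show ?thesis
            using * False v
            by (intro exI [of _ T] exI [of _ "insert v R"] exI [of _ W'] conjI) auto
        next
          case True
          obtain T R W' where *: "T \<subseteq> I \<inter> B1" "g1 T = (R, W')" "R \<subseteq> B1"
            "R \<inter> I = {}" "W1 \<subseteq> W'" "W' \<subseteq> head_pairs E f A" "fst ` W' \<subseteq> fst ` W1 \<union> T"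
            "\<forall>u. real (labelled_degree W' u) \<le> 4 * s"
            "real (card W') \<ge> real (card W1) + t * real (card T)"
            "real (card (B1 - R - T - {u. real (labelled_degree W' u) \<ge> 3 * s})) < m"
            using g1 [THEN spec, of I] by (elim exE conjE) (rule that)
          let ?X = "{u. real (labelled_degree W' u) \<ge> 3 * s}"
          have vT: "v \<notin> T" and finT: "finite T"
            using *(1) psubset.hyps by (auto simp: B1_def intro: finite_subset)
          have "finite W'"
            using *(6) finite_head_pairs [OF \<open>finite A\<close>] finite_subset by blast
          then have "real (labelled_degree W1 u) \<le> real (labelled_degree W' u)" for u
            using *(5) by (simp add: labelled_degree_mono)
          then have "3 * s \<le> real (labelled_degree W' u)" if "3 * s \<le> real (labelled_degree W1 u)" for u
            using that by (rule order_trans [rotated])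
          \<comment> \<open>Vertices dropped as saturated in \<open>W1\<close> stay saturated in the
            larger \<open>W'\<close>, so \<open>?X\<close> already excludes them.\<close>
          then have "B - R - insert v T - ?X \<subseteq> B1 - R - T - ?X"
            by (auto simp: B1_def)
          then have "card (B - R - insert v T - ?X) \<le> card (B1 - R - T - ?X)"
            using psubset.hyps by (intro card_mono) (auto simp: B1_def)
          moreover have "real (card W') \<ge> real (card W) + t * real (card (insert v T))"
            using *(9) F(3) cardW1 vT finT by (simp add: algebra_simps)
          moreover have "fst ` W' \<subseteq> fst ` W \<union> insert v T"
            using *(7) by (auto simp: W1_def)
          moreover have "W \<subseteq> W'" "R \<subseteq> B" "insert v T \<subseteq> I \<inter> B"
            using *(1,3,5) v True by (auto simp: W1_def B1_def)
          ultimately show ?thesis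
            using * vT by (intro exI [of _ "insert v T"] exI [of _ R] exI [of _ W'] conjI) auto
        qed
      qed
    qed
  qed
qed

section \<open>Edge counts from bounded multiplicities and degrees\<close>

text \<open>Joining the label to the pair is injective, because \<open>f\<close> recovers the label
  as the root, and yields only edges counted by the rooting condition for \<open>u\<close> and
  \<open>w\<close>.\<close>

lemma card_head_pairs_snd_le:
  assumes "three_uniform_hypergraph V E" "rooting_function r V E f" "A \<subseteq> V"
    and "W \<subseteq> head_pairs E f A" and "u \<in> A" "w \<in> A" "u \<noteq> w"
  shows "real (card {x \<in> W. snd x = {u, w}}) \<le> r"
proof -
  let ?K = "{e \<in> E. u \<in> e \<and> w \<in> e \<and> f e \<notin> {u, w}}"
  have "finite E"
    using assms(1) finite_subset [of E "Pow V"] by (auto simp: three_uniform_hypergraph_def)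
  have pair: "insert (fst x) (snd x) \<in> E" "f (insert (fst x) (snd x)) = fst x"
    if "x \<in> W" for x
    using that assms(4) head_pairsD [of "fst x" "snd x" E f A] by auto
  have "inj_on (\<lambda>x. insert (fst x) (snd x)) {x \<in> W. snd x = {u, w}}"
  proof (rule inj_onI)
    fix x y
    assume x: "x \<in> {x \<in> W. snd x = {u, w}}" and y: "y \<in> {x \<in> W. snd x = {u, w}}"
      and eq: "insert (fst x) (snd x) = insert (fst y) (snd y)"
    have "fst x = f (insert (fst x) (snd x))" using pair(2) [of x] x by simp
    also have "\<dots> = fst y" using pair(2) [of y] y eq by simp
    finally show "x = y" using x y by (simp add: prod_eq_iff)
  qed
  moreover have "(\<lambda>x. insert (fst x) (snd x)) ` {x \<in> W. snd x = {u, w}} \<subseteq> ?K"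
  proof (rule image_subsetI)
    fix x
    assume x: "x \<in> {x \<in> W. snd x = {u, w}}"
    \<comment> \<open>Three-uniformity forces the root to differ from \<open>u\<close> and
      \<open>w\<close>.\<close>
    then have "card (insert (fst x) {u, w}) = 3"
      using pair(1) [of x] assms(1) by (auto simp: three_uniform_hypergraph_def)
    then have "fst x \<notin> {u, w}"
      using assms(7) by (auto simp: insert_absorb)
    then show "insert (fst x) (snd x) \<in> ?K"
      using x pair [of x] by auto
  qed
  ultimately have "card {x \<in> W. snd x = {u, w}} \<le> card ?K"
    by (rule card_inj_on_le) (simp add: \<open>finite E\<close>)
  moreover have "real (card ?K) \<le> r"
    using assms(2,3,5,6,7) unfolding rooting_function_def by blast
  ultimately show ?thesis by linarith
qed

text \<open>Each vertex of \<open>B\<close> has fewer than \<open>d\<close> neighbours in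
  \<open>B\<close>, each joined to it by at most \<open>r\<close> labelled edges; summing degrees
  counts every edge twice.\<close>

lemma card_head_pairs_inside_le:
  assumes "three_uniform_hypergraph V E" "rooting_function r V E f" "finite A" "A \<subseteq> V" "r \<ge> 0"
    and W: "W \<subseteq> head_pairs E f A" and "B \<subseteq> A"
    and deg: "\<forall>u\<in>B. real (card {w \<in> B. \<exists>x\<in>W. snd x = {u, w}}) < d"
  shows "2 * real (card {x \<in> W. snd x \<subseteq> B}) \<le> r * d * real (card B)"
proof -
  let ?WB = "{x \<in> W. snd x \<subseteq> B}"
  have finW: "finite W"
    using W finite_head_pairs [OF assms(3)] finite_subset by blast
  have finB: "finite B" using assms(3,7) finite_subset by blast
  have card2: "card (snd x) = 2" if "x \<in> W" for x
    using that W head_pairsD(3) [of "fst x" "snd x"] by auto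
  have "real (labelled_degree ?WB u) \<le> r * d" if u: "u \<in> B" for u
  proof -
    let ?N = "{w \<in> B. \<exists>x\<in>W. snd x = {u, w}}"
    have "{x \<in> ?WB. u \<in> snd x} \<subseteq> (\<Union>w\<in>?N. {x \<in> W. snd x = {u, w}})"
    proof
      fix x
      assume x: "x \<in> {x \<in> ?WB. u \<in> snd x}"
      obtain a b where "snd x = {a, b}"
        using card2 [of x] x by (auto simp: card_2_iff)
      then obtain w where "snd x = {u, w}"
        using x by auto
      then show "x \<in> (\<Union>w\<in>?N. {x \<in> W. snd x = {u, w}})"
        using x by auto
    qed
    then have "labelled_degree ?WB u \<le> card (\<Union>w\<in>?N. {x \<in> W. snd x = {u, w}})"
      unfolding labelled_degree_def using finW finB by (intro card_mono) auto
    also have "\<dots> \<le> (\<Sum>w\<in>?N. card {x \<in> W. snd x = {u, w}})"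
      using finB by (intro card_UN_le) auto
    finally have "real (labelled_degree ?WB u) \<le> (\<Sum>w\<in>?N. real (card {x \<in> W. snd x = {u, w}}))"
      unfolding of_nat_sum [symmetric] of_nat_le_iff .
    also have "\<dots> \<le> (\<Sum>w\<in>?N. r)"
    proof (rule sum_mono)
      fix w
      assume w: "w \<in> ?N"
      then have "u \<noteq> w"
        using card2 by fastforce
      then show "real (card {x \<in> W. snd x = {u, w}}) \<le> r"
        using card_head_pairs_snd_le [OF assms(1,2,4) W, of u w] u w assms(7) by blast
    qed
    also have "\<dots> = r * real (card ?N)" by simp
    also have "\<dots> \<le> r * d"
      using deg u assms(5) by (intro mult_left_mono) (auto intro: less_imp_le)
    finally show ?thesis .
  qed
  then have "(\<Sum>u\<in>B. real (labelled_degree ?WB u)) \<le> (\<Sum>u\<in>B. r * d)"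
    by (rule sum_mono)
  moreover have "(\<Sum>u\<in>B. labelled_degree ?WB u) = 2 * card ?WB"
    using finW finB card2 by (intro sum_labelled_degree) auto
  then have "(\<Sum>u\<in>B. real (labelled_degree ?WB u)) = 2 * real (card ?WB)"
    unfolding of_nat_sum [symmetric] by simp
  ultimately show ?thesis by (simp add: mult.commute)
qed

text \<open>An edge not inside \<open>B\<close> meets \<open>A - B\<close>, where each vertex
  accounts for at most \<open>D\<close> edges.\<close>

lemma card_labelled_le:
  assumes "finite A" "finite W" "B \<subseteq> A" "\<forall>x\<in>W. snd x \<subseteq> A"
    and "\<forall>u. real (labelled_degree W u) \<le> D"
  shows "real (card W) \<le> real (card {x \<in> W. snd x \<subseteq> B}) + D * real (card (A - B))"
proof -
  have "W \<subseteq> {x \<in> W. snd x \<subseteq> B} \<union> (\<Union>u\<in>A - B. {x \<in> W. u \<in> snd x})"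
    using assms(4) by blast
  then have "card W \<le> card ({x \<in> W. snd x \<subseteq> B} \<union> (\<Union>u\<in>A - B. {x \<in> W. u \<in> snd x}))"
    using assms(1,2) by (intro card_mono) auto
  also have "\<dots> \<le> card {x \<in> W. snd x \<subseteq> B} + card (\<Union>u\<in>A - B. {x \<in> W. u \<in> snd x})"
    by (rule card_Un_le)
  also have "card (\<Union>u\<in>A - B. {x \<in> W. u \<in> snd x}) \<le> (\<Sum>u\<in>A - B. labelled_degree W u)"
    unfolding labelled_degree_def using assms(1) by (intro card_UN_le) auto
  finally have "real (card W)
      \<le> real (card {x \<in> W. snd x \<subseteq> B}) + (\<Sum>u\<in>A - B. real (labelled_degree W u))"
    unfolding of_nat_sum [symmetric] of_nat_add [symmetric] of_nat_le_iff by simp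
  also have "(\<Sum>u\<in>A - B. real (labelled_degree W u)) \<le> (\<Sum>u\<in>A - B. D)"
    using assms(5) by (intro sum_mono) auto
  finally show ?thesis by (simp add: mult.commute)
qed

section \<open>One container step\<close>

lemma container_step:
  fixes \<epsilon> s t r N :: real
  assumes pos: "\<epsilon> > 0" "s > 0" "t > 0" "r > 0" "N > 0"
    and eps: "\<epsilon> \<le> 1 / 10" and small: "4 * s / t + r / (2 * \<epsilon> * s) \<le> \<epsilon>"
    and hyp: "three_uniform_hypergraph V E" "rooting_function r V E f" "nice V E f \<epsilon> N s t"
    and A: "A \<subseteq> V" "real (card A) > (1 + 100 * \<epsilon>) * N"
  shows "\<exists>\<C> \<subseteq> Pow A. (\<forall>I \<subseteq> A. independent_set V E I \<longrightarrow> (\<exists>C\<in>\<C>. I \<subseteq> C)) \<and>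
           real (card \<C>) \<le>
             2 powr (real (card A) * (binary_entropy (2 * s / t) + binary_entropy (r / (4 * \<epsilon> * s)))) \<and>
           (\<forall>C\<in>\<C>. real (card C) \<le> (1 - \<epsilon> / 2) * real (card A))"
proof -
  define n where "n = real (card A)"
  \<comment> \<open>The smallness hypothesis reads \<open>2 * p + 2 * q \<le> \<epsilon>\<close>.
    The threshold \<open>d\<close> is \<open>1 / q\<close>, so \<open>d * card S \<le> n\<close>
    means \<open>card S \<le> q * n\<close>, while \<open>r * d = 4 * \<epsilon> * s\<close> keeps
    few edges inside the graph container.\<close>
  define p where "p = 2 * s / t"
  define q where "q = r / (4 * \<epsilon> * s)"
  define d where "d = 4 * \<epsilon> * s / r"
  have "finite A"
    using A(1) hyp(1) finite_subset by (auto simp: three_uniform_hypergraph_def)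
  have "p > 0" "q > 0" "d > 0"
    using pos by (auto simp: p_def q_def d_def)
  have "4 * s / t = 2 * p" "r / (2 * \<epsilon> * s) = 2 * q"
    by (simp_all add: p_def q_def)
  then have pq: "p \<le> \<epsilon> / 2" "q \<le> \<epsilon> / 2"
    using small \<open>p > 0\<close> \<open>q > 0\<close> by linarith+
  have "n > 0"
    using A(2) pos by (smt (verit) mult_pos_pos n_def)
  have eps_n_pos: "\<epsilon> * n > 0" using pos \<open>n > 0\<close> by simp

  have elig: "\<exists>v. eligible E f B s t v" if "B \<subseteq> A" "real (card B) \<ge> (1 + \<epsilon>) * N" for B
    using that hyp(3) A(1) by (auto simp: nice_def)
  have "\<exists>g. \<forall>I. \<exists>T \<subseteq> I \<inter> A. \<exists>R W. g T = (R, W) \<and> R \<subseteq> A \<and> R \<inter> I = {} \<and>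
      {} \<subseteq> W \<and> W \<subseteq> head_pairs E f A \<and> fst ` W \<subseteq> fst ` ({} :: ('a \<times> 'a set) set) \<union> T \<and>
      (\<forall>u. real (labelled_degree W u) \<le> 4 * s) \<and>
      real (card W) \<ge> real (card ({} :: ('a \<times> 'a set) set)) + t * real (card T) \<and>
      real (card (A - R - T - {u. real (labelled_degree W u) \<ge> 3 * s})) < (1 + \<epsilon>) * N"
    (is "\<exists>g. ?selects g")
    by (rule eligible_selection [OF \<open>finite A\<close> subset_refl empty_subsetI _ _ _ elig])
      (use pos(2) in \<open>auto simp: labelled_degree_def\<close>)
  then obtain g where g: "?selects g" ..
  let ?adj = "\<lambda>T u w. \<exists>x\<in>snd (g T). snd x = {u, w}"
  \<comment> \<open>The graph is \<open>W\<close> with labels forgotten; it depends on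
    \<open>T\<close> alone, so \<open>c\<close> can be fixed before \<open>I\<close>.\<close>
  have "\<forall>T. \<exists>c. \<forall>I. (\<forall>u\<in>I. \<forall>w\<in>I. \<not> ?adj T u w) \<longrightarrow>
           (\<exists>S \<subseteq> I \<inter> A. d * real (card S) \<le> real (card A) \<and> I \<inter> A \<subseteq> S \<union> c S \<and> c S \<subseteq> A \<and>
              (\<forall>u\<in>c S. real (card {w \<in> c S. ?adj T u w}) < d))"
    using graph_container [OF \<open>finite A\<close>] by (intro allI)
  from choice [OF this] obtain c where c: "\<forall>T I. (\<forall>u\<in>I. \<forall>w\<in>I. \<not> ?adj T u w) \<longrightarrow>
           (\<exists>S \<subseteq> I \<inter> A. d * real (card S) \<le> real (card A) \<and> I \<inter> A \<subseteq> S \<union> c T S \<and> c T S \<subseteq> A \<and>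
              (\<forall>u\<in>c T S. real (card {w \<in> c T S. ?adj T u w}) < d))" ..

  define K where "K = (\<lambda>(T, S). if real (card (fst (g T))) \<ge> \<epsilon> / 2 * n then A - fst (g T) else S \<union> c T S)"
  define P where "P = {T. T \<subseteq> A \<and> real (card T) \<le> p * n}"
  define Q where "Q = {S. S \<subseteq> A \<and> real (card S) \<le> q * n}"
  \<comment> \<open>Pairs that are not fingerprints may decode to oversized sets; these are filtered
    out.\<close>
  define \<C> where "\<C> = {C \<in> K ` (P \<times> Q). C \<subseteq> A \<and> real (card C) \<le> (1 - \<epsilon> / 2) * n}"
  have "finite P" "finite Q"
    using \<open>finite A\<close> by (auto simp: P_def Q_def)

  have "card \<C> \<le> card P * card Q"
  proof -
    have "card \<C> \<le> card (K ` (P \<times> Q))"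
      unfolding \<C>_def using \<open>finite P\<close> \<open>finite Q\<close> by (intro card_mono) auto
    also have "\<dots> \<le> card (P \<times> Q)"
      using \<open>finite P\<close> \<open>finite Q\<close> by (intro card_image_le) auto
    finally show ?thesis by (simp add: card_cartesian_product)
  qed
  then have "real (card \<C>) \<le> real (card P) * real (card Q)"
    by (metis of_nat_le_iff of_nat_mult)
  also have "\<dots> \<le> 2 powr (n * binary_entropy p) * 2 powr (n * binary_entropy q)"
    using card_small_subsets_le [OF \<open>finite A\<close>, of p] card_small_subsets_le [OF \<open>finite A\<close>, of q]
      \<open>p > 0\<close> \<open>q > 0\<close> pq eps
    by (intro mult_mono) (auto simp: P_def Q_def n_def)
  finally have card\<C>: "real (card \<C>) \<le> 2 powr (n * (binary_entropy p + binary_entropy q))"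
    by (simp add: powr_add distrib_left)

  have cover: "\<exists>C\<in>\<C>. I \<subseteq> C" if "I \<subseteq> A" and indep: "independent_set V E I" for I
  proof -
    obtain T R W where T: "T \<subseteq> I" "T \<subseteq> A" and gT: "g T = (R, W)" and R: "R \<subseteq> A" "R \<inter> I = {}"
      and W: "W \<subseteq> head_pairs E f A" "fst ` W \<subseteq> T"
        "\<forall>u. real (labelled_degree W u) \<le> 4 * s" "t * real (card T) \<le> real (card W)"
      and rest: "real (card (A - R - T - {u. real (labelled_degree W u) \<ge> 3 * s})) < (1 + \<epsilon>) * N"
      using g [THEN spec, of I] by auto
    have finW: "finite W"
      using W(1) finite_head_pairs [OF \<open>finite A\<close>] finite_subset by blast
    have W2: "\<forall>x\<in>W. snd x \<subseteq> A \<and> card (snd x) = 2"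
      using W(1) head_pairsD(2,3) [of "fst x" "snd x" E f A for x] by fastforce
    have "(\<Sum>u\<in>A. labelled_degree W u) = 2 * card W"
      using sum_labelled_degree [OF \<open>finite A\<close> finW W2] .
    then have sumW: "(\<Sum>u\<in>A. real (labelled_degree W u)) = 2 * real (card W)"
      unfolding of_nat_sum [symmetric] by simp
    \<comment> \<open>The degree bound gives \<open>card W \<le> 2 * s * n\<close>, whereas each
      element of \<open>T\<close> contributed at least \<open>t\<close> edges.\<close>
    have "(\<Sum>u\<in>A. real (labelled_degree W u)) \<le> (\<Sum>u\<in>A. 4 * s)"
      using W(3) by (intro sum_mono) auto
    then have "t * real (card T) \<le> 2 * s * n"
      using sumW W(4) by (simp add: n_def)
    then have cardT: "real (card T) \<le> p * n"
      using pos by (simp add: p_def field_simps)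
    then have "T \<in> P" using T by (simp add: P_def)
    show ?thesis
    proof (cases "real (card R) \<ge> \<epsilon> / 2 * n")
      case True
      have "card (A - R) = card A - card R" "card R \<le> card A"
        using R(1) \<open>finite A\<close> by (auto intro!: card_Diff_subset card_mono intro: finite_subset)
      then have "real (card (A - R)) \<le> (1 - \<epsilon> / 2) * n"
        using True by (simp add: n_def of_nat_diff algebra_simps)
      \<comment> \<open>Here \<open>T\<close> alone determines the container; the empty set fills
        the slot of \<open>S\<close>.\<close>
      moreover have "{} \<in> Q"
        using \<open>q > 0\<close> \<open>n > 0\<close> by (simp add: Q_def)
      moreover have "K (T, {}) = A - R"
        using True gT by (simp add: K_def)
      ultimately have "A - R \<in> \<C>"
        using \<open>T \<in> P\<close> unfolding \<C>_def by (force intro: rev_image_eqI)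
      then show ?thesis
        using \<open>I \<subseteq> A\<close> R(2) by blast
    next
      case False
      \<comment> \<open>An edge of \<open>W\<close> within \<open>I\<close>, together with its label
        in \<open>T\<close>, would be a hyperedge inside \<open>I\<close>.\<close>
      have "\<not> ?adj T u w" if "u \<in> I" "w \<in> I" for u w
      proof
        assume "?adj T u w"
        then obtain v where v: "(v, {u, w}) \<in> W"
          using gT by auto
        then have "v \<in> I" "insert v {u, w} \<in> E"
          using W(1,2) T(1) head_pairsD(4) by force+
        then show False
          using that indep by (auto simp: independent_set_def)
      qed
      then have "\<exists>S \<subseteq> I \<inter> A. d * real (card S) \<le> real (card A) \<and> I \<inter> A \<subseteq> S \<union> c T S \<and> c T S \<subseteq> A \<and>
              (\<forall>u\<in>c T S. real (card {w \<in> c T S. ?adj T u w}) < d)"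
        using c [THEN spec, of T, THEN spec, of I] by blast
      then obtain S where S: "S \<subseteq> I \<inter> A" "d * real (card S) \<le> real (card A)" "I \<inter> A \<subseteq> S \<union> c T S"
          "c T S \<subseteq> A" "\<forall>u\<in>c T S. real (card {w \<in> c T S. ?adj T u w}) < d"
        by (elim exE conjE) (rule that)
      define B where "B = c T S"
      have "B \<subseteq> A" using S(4) by (simp add: B_def)
      have cardS: "real (card S) \<le> q * n"
        using S(2) pos by (simp add: d_def q_def n_def field_simps)
      then have "S \<in> Q" using S(1) by (simp add: Q_def)
      let ?X = "{u \<in> A. real (labelled_degree W u) \<ge> 3 * s}"

      have "card A \<le> card (R \<union> T \<union> (?X \<union> (A - R - T - {u. real (labelled_degree W u) \<ge> 3 * s})))"
        using \<open>finite A\<close> R(1) T(2) by (intro card_mono) (auto intro: finite_subset)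
      also have "\<dots> \<le> card R + card T + (card ?X + card (A - R - T - {u. real (labelled_degree W u) \<ge> 3 * s}))"
        by (intro order_trans [OF card_Un_le] add_mono card_Un_le)
      finally have "n \<le> real (card R) + real (card T) + real (card ?X) + (1 + \<epsilon>) * N"
        using rest unfolding n_def by linarith
      \<comment> \<open>The product \<open>(1 - 9 * \<epsilon>) * (1 + 100 * \<epsilon>)\<close>
        exceeds \<open>1 + \<epsilon>\<close> by
        \<open>90 * \<epsilon> - 900 * \<epsilon>^2\<close>, which is nonnegative exactly because
        \<open>\<epsilon> \<le> 1 / 10\<close>. Of the resulting \<open>9 * \<epsilon> * n\<close>,
        the sets \<open>R\<close> and \<open>T\<close> take at most half of
        \<open>\<epsilon> * n\<close> each, leaving 8 parts for \<open>?X\<close>.\<close>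
      moreover have "(1 + \<epsilon>) * N \<le> (1 - 9 * \<epsilon>) * n"
      proof -
        have "1 + \<epsilon> \<le> (1 - 9 * \<epsilon>) * (1 + 100 * \<epsilon>)"
          using pos(1) eps mult_left_mono [OF eps, of \<epsilon>] by (simp add: algebra_simps)
        then have "(1 + \<epsilon>) * N \<le> (1 - 9 * \<epsilon>) * ((1 + 100 * \<epsilon>) * N)"
          using pos(5) by (simp add: mult_right_mono mult.assoc [symmetric])
        also have "\<dots> \<le> (1 - 9 * \<epsilon>) * n"
          using A(2) eps by (intro mult_left_mono) (auto simp: n_def)
        finally show ?thesis .
      qed
      moreover have "real (card T) \<le> \<epsilon> / 2 * n"
        using cardT mult_right_mono [OF pq(1), of n] \<open>n > 0\<close> by linarith
      ultimately have cardX: "8 * (\<epsilon> * n) \<le> real (card ?X)"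
        using False by (simp add: algebra_simps)

      have "real (card ?X) * (3 * s) \<le> (\<Sum>u\<in>?X. real (labelled_degree W u))"
        by (intro sum_bounded_below) auto
      also have "\<dots> \<le> (\<Sum>u\<in>A. real (labelled_degree W u))"
        using \<open>finite A\<close> by (intro sum_mono2) auto
      finally have "3 * s * real (card ?X) \<le> 2 * real (card W)"
        using sumW by (simp add: mult.commute)
      moreover have "3 * s * (8 * (\<epsilon> * n)) \<le> 3 * s * real (card ?X)"
        using cardX pos(2) by (intro mult_left_mono) auto
      moreover have "real (card W) \<le> real (card {x \<in> W. snd x \<subseteq> B}) + 4 * s * real (card (A - B))"
        using W2 W(3) by (intro card_labelled_le [OF \<open>finite A\<close> finW \<open>B \<subseteq> A\<close>]) auto
      moreover have "2 * real (card {x \<in> W. snd x \<subseteq> B}) \<le> r * d * real (card B)"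
        using S(5) gT pos(4)
        by (intro card_head_pairs_inside_le [OF hyp(1,2) \<open>finite A\<close> A(1) _ W(1) \<open>B \<subseteq> A\<close>]) (auto simp: B_def)
      moreover have "r * d * real (card B) \<le> 4 * s * (\<epsilon> * n)"
        using card_mono [OF \<open>finite A\<close> \<open>B \<subseteq> A\<close>] pos by (simp add: d_def n_def mult.assoc)
      \<comment> \<open>Twice the number of edges is at least
        \<open>24 * \<epsilon> * s * n\<close>, of which those inside \<open>B\<close> account for
        at most \<open>4 * \<epsilon> * s * n\<close>. So \<open>A - B\<close> has at least
        \<open>5 / 2 * \<epsilon> * n\<close> vertices, well above the loss from adding back
        \<open>S\<close>.\<close>
      ultimately have "s * (10 * (\<epsilon> * n)) \<le> s * (4 * real (card (A - B)))"
        by (simp add: algebra_simps)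
      then have "10 * (\<epsilon> * n) \<le> 4 * real (card (A - B))"
        using pos(2) by simp
      moreover have "real (card (A - B)) = n - real (card B)"
        using \<open>B \<subseteq> A\<close> \<open>finite A\<close> by (simp add: card_Diff_subset finite_subset of_nat_diff card_mono n_def)
      moreover have "real (card (S \<union> B)) \<le> real (card S) + real (card B)"
        using card_Un_le [of S B] by linarith
      moreover have "real (card S) \<le> \<epsilon> / 2 * n"
        using cardS mult_right_mono [OF pq(2), of n] \<open>n > 0\<close> by linarith
      ultimately have "real (card (S \<union> B)) \<le> (1 - \<epsilon> / 2) * n"
        using eps_n_pos by (simp add: algebra_simps)
      moreover have "K (T, S) = S \<union> B"
        using False gT by (simp add: K_def B_def)
      ultimately have "S \<union> B \<in> \<C>"
        using \<open>T \<in> P\<close> \<open>S \<in> Q\<close> \<open>B \<subseteq> A\<close> S(1) unfolding \<C>_def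
        by (intro CollectI conjI image_eqI [where x = "(T, S)"]) auto
      then show ?thesis
        using S(3) \<open>I \<subseteq> A\<close> by (auto simp: B_def)
    qed
  qed
  show ?thesis
    using cover card\<C> unfolding p_def q_def n_def
    by (intro exI [of _ \<C>]) (auto simp: \<C>_def n_def)
qed

section \<open>Iteration of the step and the final bound\<close>

text \<open>Replace each container that is still too large by containers of its own. The exponent is
  chosen to reproduce itself: the cost \<open>card A * h\<close> of one step plus the bound for a
  set smaller by the factor \<open>1 - \<epsilon> / 2\<close> is again the bound for
  \<open>A\<close>.\<close>

lemma container_iteration:
  fixes b h \<epsilon> :: real
  assumes "finite A" "P {}" "\<epsilon> > 0" "h \<ge> 0" "b > 0"
    and step: "\<And>B. B \<subseteq> A \<Longrightarrow> real (card B) > b \<Longrightarrow>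
      \<exists>\<C> \<subseteq> Pow B. (\<forall>I \<subseteq> B. P I \<longrightarrow> (\<exists>C\<in>\<C>. I \<subseteq> C)) \<and> real (card \<C>) \<le> 2 powr (real (card B) * h) \<and>
        (\<forall>C\<in>\<C>. real (card C) \<le> (1 - \<epsilon> / 2) * real (card B))"
  shows "\<exists>\<C> \<subseteq> Pow A. (\<forall>I \<subseteq> A. P I \<longrightarrow> (\<exists>C\<in>\<C>. I \<subseteq> C)) \<and>
           real (card \<C>) \<le> 2 powr (2 / \<epsilon> * real (card A) * h) \<and> (\<forall>C\<in>\<C>. real (card C) \<le> b)"
  using assms(1) step
proof (induction A rule: finite_psubset_induct)
  case (psubset A)
  show ?case
  proof (cases "real (card A) \<le> b")
    case True
    have "(1::real) \<le> 2 powr (2 / \<epsilon> * real (card A) * h)"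
      using assms(3,4) by (intro ge_one_powr_ge_zero) auto
    then show ?thesis
      using True by (intro exI [of _ "{A}"]) auto
  next
    case False
    then have "b < real (card A)" by simp
    from psubset.prems [OF subset_refl this]
    obtain \<C> where \<C>: "\<C> \<subseteq> Pow A" "\<forall>I \<subseteq> A. P I \<longrightarrow> (\<exists>C\<in>\<C>. I \<subseteq> C)"
      "real (card \<C>) \<le> 2 powr (real (card A) * h)"
      "\<forall>C\<in>\<C>. real (card C) \<le> (1 - \<epsilon> / 2) * real (card A)"
      by (elim exE conjE) (rule that)
    have "\<forall>C\<in>\<C>. \<exists>\<D>. \<D> \<subseteq> Pow C \<and> (\<forall>I \<subseteq> C. P I \<longrightarrow> (\<exists>D\<in>\<D>. I \<subseteq> D)) \<and>
           real (card \<D>) \<le> 2 powr (2 / \<epsilon> * real (card C) * h) \<and> (\<forall>D\<in>\<D>. real (card D) \<le> b)"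
    proof
      fix C
      assume C: "C \<in> \<C>"
      \<comment> \<open>Since \<open>b\<close> is positive, \<open>A\<close> is nonempty, so every
        container is a proper subset and the induction applies.\<close>
      have "\<epsilon> / 2 * real (card A) > 0"
        using assms(3,5) \<open>b < real (card A)\<close> by simp
      then have "card C \<noteq> card A"
        using \<C>(4) C by (auto simp: algebra_simps)
      then have "C \<subset> A" using \<C>(1) C by auto
      then show "\<exists>\<D>. \<D> \<subseteq> Pow C \<and> (\<forall>I \<subseteq> C. P I \<longrightarrow> (\<exists>D\<in>\<D>. I \<subseteq> D)) \<and>
           real (card \<D>) \<le> 2 powr (2 / \<epsilon> * real (card C) * h) \<and> (\<forall>D\<in>\<D>. real (card D) \<le> b)"
        by (intro psubset.IH psubset.prems) auto
    qed
    from bchoice [OF this] obtain \<D> where \<D>: "\<forall>C\<in>\<C>. \<D> C \<subseteq> Pow C \<and>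
        (\<forall>I \<subseteq> C. P I \<longrightarrow> (\<exists>D\<in>\<D> C. I \<subseteq> D)) \<and>
        real (card (\<D> C)) \<le> 2 powr (2 / \<epsilon> * real (card C) * h) \<and> (\<forall>D\<in>\<D> C. real (card D) \<le> b)" ..
    have \<D>_covers: "\<D> C \<subseteq> Pow C" "\<forall>I \<subseteq> C. P I \<longrightarrow> (\<exists>D\<in>\<D> C. I \<subseteq> D)" "\<forall>D\<in>\<D> C. real (card D) \<le> b"
      if "C \<in> \<C>" for C
      using bspec [OF \<D> that] by - (elim conjE, assumption)+
    have fin: "finite \<C>" using \<C>(1) psubset.hyps by (simp add: finite_subset)
    have "real (card (\<Union>C\<in>\<C>. \<D> C)) \<le> (\<Sum>C\<in>\<C>. real (card (\<D> C)))"
      unfolding of_nat_sum [symmetric] of_nat_le_iff by (rule card_UN_le [OF fin])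
    also have "\<dots> \<le> (\<Sum>C\<in>\<C>. 2 powr (2 / \<epsilon> * ((1 - \<epsilon> / 2) * real (card A)) * h))"
    proof (rule sum_mono)
      fix C
      assume C: "C \<in> \<C>"
      then have "2 / \<epsilon> * real (card C) * h \<le> 2 / \<epsilon> * ((1 - \<epsilon> / 2) * real (card A)) * h"
        using \<C>(4) assms(3,4) by (intro mult_right_mono mult_left_mono) auto
      then have "2 powr (2 / \<epsilon> * real (card C) * h)
          \<le> 2 powr (2 / \<epsilon> * ((1 - \<epsilon> / 2) * real (card A)) * h)"
        by (intro powr_mono) auto
      with bspec [OF \<D> C]
      show "real (card (\<D> C)) \<le> 2 powr (2 / \<epsilon> * ((1 - \<epsilon> / 2) * real (card A)) * h)"
        by linarith
    qed
    also have "\<dots> = real (card \<C>) * 2 powr (2 / \<epsilon> * ((1 - \<epsilon> / 2) * real (card A)) * h)"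
      by simp
    also have "\<dots> \<le> 2 powr (real (card A) * h) * 2 powr (2 / \<epsilon> * ((1 - \<epsilon> / 2) * real (card A)) * h)"
      using \<C>(3) by (rule mult_right_mono) simp
    \<comment> \<open>The exponents add up by
      \<open>1 + 2 / \<epsilon> * (1 - \<epsilon> / 2) = 2 / \<epsilon>\<close>.\<close>
    also have "\<dots> = 2 powr (2 / \<epsilon> * real (card A) * h)"
      using assms(3) unfolding powr_add [symmetric]
      by (intro arg_cong [where f = "\<lambda>x. 2 powr x"]) (simp add: field_simps)
    finally have "real (card (\<Union>C\<in>\<C>. \<D> C)) \<le> 2 powr (2 / \<epsilon> * real (card A) * h)" .
    moreover have "(\<Union>C\<in>\<C>. \<D> C) \<subseteq> Pow A"
      using \<D>_covers(1) \<C>(1) by blast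
    moreover have "\<forall>D\<in>(\<Union>C\<in>\<C>. \<D> C). real (card D) \<le> b"
      using \<D>_covers(3) by auto
    moreover have "\<exists>D\<in>(\<Union>C\<in>\<C>. \<D> C). I \<subseteq> D" if I: "I \<subseteq> A" "P I" for I
    proof -
      obtain C where C: "C \<in> \<C>" "I \<subseteq> C"
        using \<C>(2) [THEN spec, THEN mp, THEN mp, OF I] ..
      then show ?thesis
        using \<D>_covers(2) [OF C(1), THEN spec, THEN mp, THEN mp, OF C(2) I(2)] by auto
    qed
    ultimately show ?thesis
      by (intro exI [of _ "\<Union>C\<in>\<C>. \<D> C"] conjI allI impI)
  qed
qed

theorem theorem7:
  fixes V :: "'a set" and E :: "'a set set" and f :: "'a set \<Rightarrow> 'a"
    and \<epsilon> s t r N :: real and M :: nat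
  assumes "\<epsilon> > 0" and "s > 0" and "t > 0" and "r > 0" and "N > 0" and "M > 0"
    and "\<epsilon> \<le> 1 / 10"
    and "4 * s / t + r / (2 * \<epsilon> * s) \<le> \<epsilon>"
    and "real M \<ge> (1 + 100 * \<epsilon>) * N"
    and "three_uniform_hypergraph V E" and "card V = M"
    and "rooting_function r V E f"
    and "nice V E f \<epsilon> N s t"
  shows "\<exists>\<C> \<subseteq> Pow V.
           (\<forall>I. independent_set V E I \<longrightarrow> (\<exists>C\<in>\<C>. I \<subseteq> C)) \<and>
           log 2 (real (card \<C>))
             \<le> 2 * real M / \<epsilon> * (binary_entropy (2 * s / t) + binary_entropy (r / (4 * \<epsilon> * s))) \<and>
           (\<forall>C\<in>\<C>. real (card C) \<le> (1 + 100 * \<epsilon>) * N)"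
proof -
  let ?h = "binary_entropy (2 * s / t) + binary_entropy (r / (4 * \<epsilon> * s))"
  have pos: "2 * s / t > 0" "r / (4 * \<epsilon> * s) > 0"
    using assms(1-4) by auto
  have "4 * s / t = 2 * (2 * s / t)" "r / (2 * \<epsilon> * s) = 2 * (r / (4 * \<epsilon> * s))"
    by simp_all
  then have "2 * s / t \<le> 1 / 2" "r / (4 * \<epsilon> * s) \<le> 1 / 2"
    using assms(7,8) pos by linarith+
  then have h: "?h \<ge> 0"
    using pos binary_entropy_nonneg by (intro add_nonneg_nonneg)
  have "finite V"
    using assms(10) by (simp add: three_uniform_hypergraph_def)
  have indep: "independent_set V E {}"
    using assms(10) by (auto simp: independent_set_def three_uniform_hypergraph_def)
  have "(1 + 100 * \<epsilon>) * N > 0"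
    using assms(1,5) by simp
  from container_iteration [OF \<open>finite V\<close> indep assms(1) h this container_step, OF assms(1-5,7,8,10,12,13)]
  obtain \<C> where \<C>: "\<C> \<subseteq> Pow V" "\<forall>I \<subseteq> V. independent_set V E I \<longrightarrow> (\<exists>C\<in>\<C>. I \<subseteq> C)"
    "real (card \<C>) \<le> 2 powr (2 / \<epsilon> * real (card V) * ?h)"
    "\<forall>C\<in>\<C>. real (card C) \<le> (1 + 100 * \<epsilon>) * N"
    by blast
  \<comment> \<open>The empty independent set has a container, so the logarithm is taken of a
    positive number.\<close>
  have "finite \<C>" "\<C> \<noteq> {}"
    using \<C>(1,2) \<open>finite V\<close> indep by (auto intro: finite_subset)
  then have "real (card \<C>) > 0"
    by (simp add: card_gt_0_iff)
  then have "log 2 (real (card \<C>)) \<le> 2 / \<epsilon> * real (card V) * ?h"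
    using \<C>(3) by (simp add: log_le_iff)
  then have "log 2 (real (card \<C>)) \<le> 2 * real M / \<epsilon> * ?h"
    using assms(11) by simp
  then show ?thesis
    using \<C>(1,2,4) by (intro exI [of _ \<C>]) (auto simp: independent_set_def)
qed

end
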